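(* Let $n\ge 5$. Then \[(5n-6+\operatorname{sgn}'(n))/2\le R(\widehat{K}_n,\widehat{K}_n)\le 4n-6,\] where $\operatorname{sgn}'(n)=1$ if $n\equiv 3\pmod 4$, $\operatorname{sgn}'(n)=0$ if $n$ is even, and $\operatorname{sgn}'(n)=-1$ if $n\equiv 1\pmod 4$.
   Context: For graphs $G_1,G_2$, the Ramsey number $R(G_1,G_2)$ is the smallest positive integer $N$ such that every red-blue edge-coloring of $K_N$ contains a red copy of $G_1$ or a blue copy of $G_2$. For a graph $G$, $K_1+G$ denotes the graph obtained by adding a new vertex adjacent to every vertex of $G$. The kipas $\widehat{K}_n$ is the graph $K_1+P_{n-1}$ on $n$ vertices, where $P_{n-1}$ is the path on $n-1$ vertices. *)

theory Defs
  imports Complex_Main "HOL-Library.Ramsey"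
begin

text \<open>Simple graphs: edges are two-element subsets of the vertex set
  (\<open>nsets A 2\<close> is the set of all two-element subsets of \<open>A\<close>).\<close>

record 'a ugraph =
  verts :: "'a set"
  edges :: "'a set set"

definition simple_graph :: "'a ugraph \<Rightarrow> bool" where
  "simple_graph G \<longleftrightarrow> finite (verts G) \<and> edges G \<subseteq> nsets (verts G) 2"

definition complete_graph :: "nat \<Rightarrow> nat ugraph" where
  "complete_graph N = \<lparr>verts = {..<N}, edges = nsets {..<N} 2\<rparr>"

text \<open>The path on \<open>m\<close> vertices (not \<open>m\<close> edges).\<close>

definition path_graph :: "nat \<Rightarrow> nat ugraph" where
  "path_graph m = \<lparr>verts = {..<m}, edges = {{i, Suc i} | i. Suc i < m}\<rparr>"

text \<open>The graph \<open>K\<^sub>1 + G\<close>: the new vertex is \<open>None\<close>, the old vertices are \<open>Some v\<close>.\<close>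

definition K1_join :: "'a ugraph \<Rightarrow> 'a option ugraph" where
  "K1_join G =
     \<lparr>verts = insert None (Some ` verts G),
      edges = (\<lambda>e. Some ` e) ` edges G \<union> {{None, Some v} | v. v \<in> verts G}\<rparr>"

definition kipas :: "nat \<Rightarrow> nat option ugraph" where
  "kipas n = K1_join (path_graph (n - 1))"

text \<open>A copy of \<open>G\<close> in \<open>H\<close> is a subgraph of \<open>H\<close> isomorphic to \<open>G\<close>, not necessarily induced.\<close>

definition contains_copy :: "'b ugraph \<Rightarrow> 'a ugraph \<Rightarrow> bool" where
  "contains_copy H G \<longleftrightarrow>
     (\<exists>f. inj_on f (verts G) \<and> f ` verts G \<subseteq> verts H \<and> (\<forall>e\<in>edges G. f ` e \<in> edges H))"

datatype color = Red | Blue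

definition color_subgraph :: "'a ugraph \<Rightarrow> ('a set \<Rightarrow> color) \<Rightarrow> color \<Rightarrow> 'a ugraph" where
  "color_subgraph H c k = \<lparr>verts = verts H, edges = {e \<in> edges H. c e = k}\<rparr>"

text \<open>Colorings are total functions; their values outside the edge set play no role.\<close>

definition ramsey_number :: "'a ugraph \<Rightarrow> 'b ugraph \<Rightarrow> nat" where
  "ramsey_number G1 G2 =
     (LEAST N. N > 0 \<and>
        (\<forall>c. contains_copy (color_subgraph (complete_graph N) c Red) G1 \<or>
             contains_copy (color_subgraph (complete_graph N) c Blue) G2))"

definition sgn' :: "nat \<Rightarrow> real" where
  "sgn' n = (if n mod 4 = 3 then 1 else if even n then 0 else -1)"

lemma simple_graph_kipas: "simple_graph (kipas n)"
  by (auto simp: simple_graph_def kipas_def K1_join_def path_graph_def)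

lemma card_verts_kipas: "n \<ge> 1 \<Longrightarrow> card (verts (kipas n)) = n"
  by (simp add: kipas_def K1_join_def path_graph_def card_image)

end

theory Submission
  imports Defs
begin

text \<open>
  Upper bound: put \<open>m = n - 1\<close>. Every vertex of the complete graph on
  \<open>4n - 6\<close> vertices has at least \<open>2m - 1\<close> neighbours
  in one colour, say red, and it suffices to find among them a red path on \<open>m\<close> vertices or a blue
  kipas. Suppose that there is no such red path. If some vertex has red degree less than \<open>m/2\<close>, it has
  at least \<open>m + \<lfloor>m/2\<rfloor> - 1\<close> blue neighbours, and these contain a blue path on \<open>m\<close> vertices by
  the Gerencser--Gyarfas theorem. Otherwise, by Dirac's argument, all red components have more than \<open>m/2\<close>
  and fewer than \<open>m\<close> vertices, so there are at least three of them; a vertex in one, with a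
  path alternating between two others, is a blue kipas.

  Lower bound: a red clique on \<open>n - 1\<close> vertices, joined in blue to about \<open>3n/2\<close> vertices on which
  blue is a disjoint union of circulant graphs of degree about \<open>n/2\<close>.
\<close>

section \<open>Paths as lists\<close>

text \<open>The ambient vertex set is kept apart, as a condition on \<open>set xs\<close>.
  Distinctness keeps \<open>S\<close> off the diagonal, so the other colour is simply the negation
  of \<open>S\<close>.\<close>

definition gpath :: "('a \<Rightarrow> 'a \<Rightarrow> bool) \<Rightarrow> 'a list \<Rightarrow> bool" where
  "gpath S xs \<longleftrightarrow> distinct xs \<and> successively S xs"

lemma gpath_append:
  "gpath S (xs @ ys) \<longleftrightarrow> gpath S xs \<and> gpath S ys \<and> set xs \<inter> set ys = {}
     \<and> (xs = [] \<or> ys = [] \<or> S (last xs) (hd ys))"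
  by (auto simp: gpath_def successively_append_iff)

lemma gpath_Cons:
  "gpath S (x # xs) \<longleftrightarrow> x \<notin> set xs \<and> gpath S xs \<and> (xs = [] \<or> S x (hd xs))"
  by (auto simp: gpath_def successively_Cons)

lemma gpath_Nil: "gpath S []"
  by (simp add: gpath_def)

lemma gpath_rev: "symp S \<Longrightarrow> gpath S (rev xs) \<longleftrightarrow> gpath S xs"
  by (metis (no_types, lifting) gpath_def distinct_rev successively_rev successively_mono sympD)

text \<open>The path alternates: it starts in \<open>B\<close>, the side that may be larger by one,
  and what remains is the same situation with the sides exchanged. The clause on
  \<open>hd xs\<close> lets the pieces join.\<close>

lemma gpath_bipartite:
  assumes "finite A" "finite B" "A \<inter> B = {}" "card A = m div 2" "card B = (m + 1) div 2"
    and "\<And>a b. a \<in> A \<Longrightarrow> b \<in> B \<Longrightarrow> S a b \<and> S b a"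
  shows "\<exists>xs. gpath S xs \<and> length xs = m \<and> set xs \<subseteq> A \<union> B \<and> (xs \<noteq> [] \<longrightarrow> hd xs \<in> B)"
  using assms
proof (induction m arbitrary: A B)
  case 0
  then show ?case by (auto simp: gpath_Nil)
next
  case (Suc m)
  then obtain b where b: "b \<in> B" by fastforce
  have "\<exists>xs. gpath S xs \<and> length xs = m \<and> set xs \<subseteq> (B - {b}) \<union> A \<and> (xs \<noteq> [] \<longrightarrow> hd xs \<in> A)"
    using Suc.prems b by (intro Suc.IH) auto
  then obtain xs where xs: "gpath S xs" "length xs = m" "set xs \<subseteq> (B - {b}) \<union> A"
    "xs \<noteq> [] \<longrightarrow> hd xs \<in> A" by blast
  have "gpath S (b # xs)"
    using xs b Suc.prems(3,6) by (auto simp: gpath_Cons)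
  then show ?case
    using xs b by (intro exI[of _ "b # xs"]) auto
qed

section \<open>Two-coloured paths\<close>

text \<open>Of two vertices, one is joined to two of the ends of three chains, because each end is joined
  to one of them; so each pair of vertices reduces the number of chains by one.\<close>

lemma two_chains:
  fixes X :: "nat \<Rightarrow> 'a"
  assumes "symp S" "finite W" "card W = t + 2" "inj_on X {1..2*t}" "X ` {1..2*t} \<inter> W = {}"
    and "\<And>r i. r \<in> W \<Longrightarrow> i < t \<Longrightarrow> S r (X (2*i+1)) \<or> S r (X (2*i+2))"
  shows "\<exists>c1 c2. gpath S c1 \<and> gpath S c2 \<and> set c1 \<inter> set c2 = {} \<and> c1 \<noteq> [] \<and> c2 \<noteq> []
     \<and> hd c1 \<in> W \<and> last c1 \<in> W \<and> hd c2 \<in> W \<and> last c2 \<in> W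
     \<and> length c1 + length c2 = 2*t + 2 \<and> set c1 \<union> set c2 \<subseteq> W \<union> X ` {1..2*t}"
  using assms(2-)
proof (induction t arbitrary: W)
  case 0
  then obtain a b where "W = {a,b}" "a \<noteq> b"
    by (metis add_0 card_2_iff)
  then show ?case
    by (intro exI[of _ "[a]"] exI[of _ "[b]"]) (auto simp: gpath_def)
next
  case (Suc t)
  \<comment> \<open>\<open>r\<close> is set aside as a third chain of one vertex.\<close>
  then obtain r where r: "r \<in> W" by fastforce
  have sub: "{1..2*t} \<subseteq> {1..2 * Suc t}" by auto
  have "\<exists>c1 c2. gpath S c1 \<and> gpath S c2 \<and> set c1 \<inter> set c2 = {} \<and> c1 \<noteq> [] \<and> c2 \<noteq> []
     \<and> hd c1 \<in> W-{r} \<and> last c1 \<in> W-{r} \<and> hd c2 \<in> W-{r} \<and> last c2 \<in> W-{r}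
     \<and> length c1 + length c2 = 2*t + 2 \<and> set c1 \<union> set c2 \<subseteq> (W-{r}) \<union> X ` {1..2*t}"
  proof (rule Suc.IH)
    show "inj_on X {1..2*t}" using Suc.prems(3) sub inj_on_subset by blast
    show "X ` {1..2*t} \<inter> (W-{r}) = {}" using Suc.prems(4) sub by blast
    show "card (W - {r}) = t + 2" using Suc.prems(1,2) r by simp
    show "\<And>x i. x \<in> W - {r} \<Longrightarrow> i < t \<Longrightarrow> S x (X (2*i+1)) \<or> S x (X (2*i+2))"
      by (rule Suc.prems(5)) auto
  qed (use Suc.prems in auto)
  then obtain c1 c2 where c: "gpath S c1" "gpath S c2" "set c1 \<inter> set c2 = {}" "c1 \<noteq> []" "c2 \<noteq> []"
     "hd c1 \<in> W-{r}" "last c1 \<in> W-{r}" "hd c2 \<in> W-{r}" "last c2 \<in> W-{r}"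
     "length c1 + length c2 = 2*t + 2" "set c1 \<union> set c2 \<subseteq> (W-{r}) \<union> X ` {1..2*t}"
    by blast
  define Z where "Z = {X (2*t+1), X (2*t+2)}"
  have "\<exists>z\<in>Z. S r z \<and> S (hd c1) z \<or> S r z \<and> S (hd c2) z \<or> S (hd c1) z \<and> S (hd c2) z"
    using Suc.prems(5)[of r t] Suc.prems(5)[of "hd c1" t] Suc.prems(5)[of "hd c2" t] r c(6,8)
    by (auto simp: Z_def)
  then obtain z where z: "z \<in> Z"
    "S r z \<and> S (hd c1) z \<or> S r z \<and> S (hd c2) z \<or> S (hd c1) z \<and> S (hd c2) z" by blast
  obtain j where j: "j \<in> {1..2 * Suc t}" "j \<notin> {1..2*t}" "z = X j"
    using z(1) that[of "2*t+1"] that[of "2*t+2"] by (auto simp: Z_def)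
  have zX: "z \<in> X ` {1..2 * Suc t}" "z \<notin> X ` {1..2*t}"
    unfolding j(3) using j(1,2) inj_on_image_mem_iff[OF Suc.prems(3) j(1) sub]
    by (simp_all only: imageI simp_thms)
  have zW: "z \<notin> W" using zX Suc.prems(4) by blast
  have rX: "r \<notin> X ` {1..2*t}" using Suc.prems(4) r sub by blast
  have zc: "z \<notin> set c1" "z \<notin> set c2" "z \<noteq> r" using c(11) zX zW r by auto
  have rc: "r \<notin> set c1" "r \<notin> set c2" using c(11) rX by auto
  have img: "X ` {1..2*t} \<subseteq> X ` {1..2 * Suc t}" using sub by blast
  note symD = sympD[OF assms(1)]
  have incl: "set c1 \<subseteq> W \<union> X ` {1..2 * Suc t}" "set c2 \<subseteq> W \<union> X ` {1..2 * Suc t}"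
    using c(11) img by blast+
  note U = c(1-10) zc rc incl zX(1) r
  from z(2) consider (a) "S r z" "S (hd c1) z" | (b) "S r z" "S (hd c2) z"
    | (c) "S (hd c1) z" "S (hd c2) z" by blast
  then show ?case
  proof cases
    case a
    have "gpath S (r # z # c1)" using a U symD by (auto simp: gpath_Cons)
    then show ?thesis using U
      by (intro exI[of _ "r # z # c1"] exI[of _ c2]) auto
  next
    case b
    have "gpath S (r # z # c2)" using b U symD by (auto simp: gpath_Cons)
    then show ?thesis using U
      by (intro exI[of _ "c1"] exI[of _ "r # z # c2"]) auto
  next
    \<comment> \<open>Here the old chains merge through \<open>z\<close>, and \<open>r\<close> alone
      is the second chain.\<close>
    case c
    have "gpath S (rev c1 @ z # c2)"
      using c U symD assms(1) by (auto simp: gpath_Cons gpath_append gpath_rev last_rev)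
    then show ?thesis using U
      by (intro exI[of _ "rev c1 @ z # c2"] exI[of _ "[r]"])
         (auto simp: gpath_Cons gpath_Nil hd_rev)
  qed
qed

text \<open>The growth step of the Gerencser--Gyarfas theorem. As \<open>xs\<close> cannot be
  lengthened, a vertex of \<open>W\<close> is \<open>S\<close>-joined to neither end of
  \<open>xs\<close> and never to two consecutive vertices, so \<open>two_chains\<close> applies in
  the other colour to pairs of inner vertices.\<close>

lemma complementary_path:
  fixes S :: "'a \<Rightarrow> 'a \<Rightarrow> bool"
  assumes sym: "symp S" and xs: "gpath S xs" "set xs \<subseteq> V" "length xs = k" "k \<ge> 1"
    and max: "\<not> (\<exists>ys. gpath S ys \<and> set ys \<subseteq> V \<and> length ys = k + 1)"
    and W: "finite W" "W \<subseteq> V - set xs" "card W \<ge> (k + 1) div 2"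
  shows "\<exists>ys. gpath (\<lambda>x y. \<not> S x y) ys \<and> set ys \<subseteq> V \<and> length ys = k + 1"
proof -
  let ?T = "\<lambda>x y. \<not> S x y"
  note symD = sympD[OF sym]
  have symT: "symp ?T" using sym by (auto simp: symp_def)
  define s where "s = (k + 1) div 2"
  obtain W' where W': "W' \<subseteq> W" "card W' = s" "finite W'"
    using W(3) by (metis obtain_subset_with_card_n s_def)
  have dist: "distinct xs" using xs(1) by (simp add: gpath_def)
  have ne: "xs \<noteq> []" using xs by auto
  have first: "?T r (hd xs)" "?T (hd xs) r" if "r \<in> W'" for r
  proof -
    have "gpath S (r # xs)" if "S r (hd xs)"
      using that W' W \<open>r \<in> W'\<close> xs by (auto simp: gpath_Cons)
    moreover have "set (r # xs) \<subseteq> V" "length (r # xs) = k + 1" using xs W W' that by auto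
    ultimately show "?T r (hd xs)" using max by blast
    then show "?T (hd xs) r" using symD by blast
  qed
  have final: "?T r (last xs)" "?T (last xs) r" if "r \<in> W'" for r
  proof -
    have "gpath S (xs @ [r])" if "S (last xs) r"
      using that W' W \<open>r \<in> W'\<close> xs by (auto simp: gpath_Cons gpath_append gpath_Nil)
    moreover have "set (xs @ [r]) \<subseteq> V" "length (xs @ [r]) = k + 1" using xs W W' that by auto
    ultimately show "?T (last xs) r" using max by blast
    then show "?T r (last xs)" using symD by blast
  qed
  have mid: "?T r (xs ! i) \<or> ?T r (xs ! (i+1))" if r: "r \<in> W'" and i: "i + 1 < k" for r i
  proof (rule ccontr)
    assume "\<not> ?thesis"
    then have S: "S r (xs ! i)" "S r (xs ! (i+1))" by auto
    have cut: "gpath S (take (i+1) xs @ drop (i+1) xs)" using xs by simp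
    have "last (take (i+1) xs) = xs ! i"
      using i xs(3) by (subst last_conv_nth) auto
    moreover have "hd (drop (i+1) xs) = xs ! (i+1)"
      using i xs(3) by (simp add: hd_drop_conv_nth)
    moreover have "r \<notin> set xs" using r W W' by blast
    ultimately have "gpath S (take (i+1) xs @ r # drop (i+1) xs)"
      using cut[unfolded gpath_append] S symD
      by (auto simp: gpath_append gpath_Cons dest: in_set_takeD in_set_dropD)
    moreover have "set (take (i+1) xs @ r # drop (i+1) xs) \<subseteq> V"
      using xs(2) r W W' by (auto dest: in_set_takeD in_set_dropD)
    moreover have "length (take (i+1) xs @ r # drop (i+1) xs) = k + 1"
      using i xs(3) by simp
    ultimately show False using max by blast
  qed
  have nin: "x \<notin> W'" if "x \<in> set xs" for x using that W W' by blast
  show ?thesis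
  proof (cases "k \<le> 2")
    \<comment> \<open>A path on at most two vertices leaves only one vertex in \<open>W'\<close>,
      too few for two chains.\<close>
    case True
    then have "s = 1" using xs(4) by (auto simp: s_def)
    then obtain r where r: "W' = {r}" using W' by (auto simp: card_1_singleton_iff)
    show ?thesis
    proof (cases "k = 1")
      case True
      then show ?thesis using first[of r] r xs(2) ne nin[of "hd xs"] W W'
        by (intro exI[of _ "[r, hd xs]"]) (auto simp: gpath_def)
    next
      case False
      then obtain a b where ab: "xs = [a,b]"
        using True xs by (auto simp: length_Suc_conv numeral_2_eq_2 le_Suc_eq)
      then show ?thesis using first[of r] final[of r] r xs(2,3) nin W W' dist
        by (intro exI[of _ "[a,r,b]"]) (auto simp: gpath_def)
    qed
  next
    case False
    define t where "t = s - 2"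
    have s: "s = t + 2" using False by (auto simp: s_def t_def)
    \<comment> \<open>The pairs will fill positions 1 to \<open>2*t\<close>, so both ends of
      \<open>xs\<close> stay free, and for \<open>k = 2*t+4\<close> also the pair at
      \<open>2*t+1\<close> and \<open>2*t+2\<close>.\<close>
    have k: "k = 2*t+3 \<or> k = 2*t + 4" using s s_def by presburger
    have Xset: "(!) xs ` {1..2*t} \<subseteq> set xs" using k xs(3) by auto
    have "\<exists>c1 c2. gpath ?T c1 \<and> gpath ?T c2 \<and> set c1 \<inter> set c2 = {} \<and> c1 \<noteq> [] \<and> c2 \<noteq> []
       \<and> hd c1 \<in> W' \<and> last c1 \<in> W' \<and> hd c2 \<in> W' \<and> last c2 \<in> W'
       \<and> length c1 + length c2 = 2*t + 2 \<and> set c1 \<union> set c2 \<subseteq> W' \<union> (!) xs ` {1..2*t}"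
    proof (rule two_chains[OF symT W'(3)])
      show "card W' = t + 2" using W' s by simp
      show "inj_on ((!) xs) {1..2*t}"
        using k xs(3) by (intro inj_on_nth dist) auto
      show "(!) xs ` {1..2*t} \<inter> W' = {}" using Xset nin by blast
      show "?T r (xs ! (2*i+1)) \<or> ?T r (xs ! (2*i+2))" if "r \<in> W'" "i < t" for r i
        using mid[of r "2*i+1"] that k by auto
    qed
    then obtain c1 c2 where c: "gpath ?T c1" "gpath ?T c2" "set c1 \<inter> set c2 = {}" "c1 \<noteq> []" "c2 \<noteq> []"
       "hd c1 \<in> W'" "last c1 \<in> W'" "hd c2 \<in> W'" "last c2 \<in> W'"
       "length c1 + length c2 = 2*t + 2" "set c1 \<union> set c2 \<subseteq> W' \<union> (!) xs ` {1..2*t}"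
      by blast
    have un: "xs ! j \<notin> set c1 \<union> set c2" if "j < k" "j \<notin> {1..2*t}" for j
    proof -
      have "xs ! j \<notin> (!) xs ` {1..2*t}"
        using that k xs(3) dist by (auto simp: nth_eq_iff_index_eq)
      moreover have "xs ! j \<notin> W'" using that xs(3) by (intro nin) auto
      ultimately show ?thesis using c(11) by blast
    qed
    have hdx: "hd xs = xs ! 0" using ne by (simp add: hd_conv_nth)
    have lastx: "last xs = xs ! (k-1)" using ne xs(3) by (simp add: last_conv_nth)
    have h: "hd xs \<notin> set c1 \<union> set c2" using un[of 0] hdx k by auto
    have l: "last xs \<notin> set c1 \<union> set c2" using un[of "k-1"] lastx k by auto
    have hl: "hd xs \<noteq> last xs"
      using dist k xs(3) unfolding hdx lastx by (subst nth_eq_iff_index_eq) auto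
    \<comment> \<open>Both ends of \<open>xs\<close> are joined in the other colour to all of
      \<open>W'\<close>, where the chains begin and end, so they link the chains into a path on
      \<open>2*t+4\<close> vertices.\<close>
    define p where "p = c1 @ hd xs # c2 @ [last xs]"
    have p: "gpath ?T p" using c h l hl first final
      by (auto simp: p_def gpath_append gpath_Cons gpath_Nil)
    have "set c1 \<union> set c2 \<subseteq> V" using c(11) Xset xs(2) W W' by blast
    then have pV: "set p \<subseteq> V" using xs(2) ne by (auto simp: p_def)
    have lp: "length p = 2*t+4" using c(10) by (simp add: p_def)
    show ?thesis
    proof (cases "k = 2*t+3")
      case True
      then show ?thesis using p pV lp by auto
    next
      case False
      then have k: "k = 2*t+4" using k by simp
      \<comment> \<open>One vertex is still missing: of the free pair, one is joined to the start of
        \<open>p\<close>.\<close>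
      obtain j where j: "j = 2*t+1 \<or> j = 2*t+2" "?T (hd c1) (xs ! j)"
        using mid[OF c(6), of "2*t+1"] k by auto
      have "xs ! j \<notin> set c1 \<union> set c2" using un[of j] j k by auto
      moreover have "xs ! j \<noteq> hd xs" "xs ! j \<noteq> last xs"
        using dist k xs(3) j(1) unfolding hdx lastx by (auto simp: nth_eq_iff_index_eq)
      moreover have "hd p = hd c1" "p \<noteq> []" using c by (auto simp: p_def)
      moreover have "?T (xs ! j) (hd c1)" using j symD by blast
      ultimately have "gpath ?T (xs ! j # p)" using p
        by (auto simp: gpath_Cons) (auto simp: p_def)
      moreover have "xs ! j \<in> V" using nth_mem[of j xs] j(1) k xs(2,3) by auto
      ultimately show ?thesis using pV lp k by (intro exI[of _ "xs ! j # p"]) auto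
    qed
  qed
qed

text \<open>The bound of Gerencser and Gyarfas. A monochromatic path grows one vertex at a time,
  changing colour whenever \<open>complementary_path\<close> has to be applied.\<close>

lemma path_path_ramsey:
  assumes sym: "symp S" and V: "finite V" "card V \<ge> m + m div 2 - 1" and m: "m \<ge> 2"
  shows "\<exists>xs. set xs \<subseteq> V \<and> length xs = m \<and> (gpath S xs \<or> gpath (\<lambda>x y. \<not> S x y) xs)"
proof -
  have "\<exists>xs. set xs \<subseteq> V \<and> length xs = j \<and> (gpath S xs \<or> gpath (\<lambda>x y. \<not> S x y) xs)"
    if "1 \<le> j" "j \<le> m" for j
    using that
  proof (induction j rule: nat_induct_at_least)
    case base
    have "m + m div 2 - 1 > 0" using m by simp
    then have "V \<noteq> {}" using V by auto
    then obtain x where "x \<in> V" by blast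
    then show ?case by (intro exI[of _ "[x]"]) (auto simp: gpath_def)
  next
    case (Suc j)
    then obtain xs where xs: "set xs \<subseteq> V" "length xs = j" "gpath S xs \<or> gpath (\<lambda>x y. \<not> S x y) xs"
      by auto
    have step: "\<exists>ys. set ys \<subseteq> V \<and> length ys = Suc j \<and> (gpath T ys \<or> gpath (\<lambda>x y. \<not> T x y) ys)"
      if T: "symp T" "gpath T xs" for T
    proof (rule ccontr)
      assume *: "\<not> ?thesis"
      have "card (set xs) = j" using T xs by (simp add: gpath_def distinct_card)
      \<comment> \<open>As \<open>j + 1 \<le> m\<close>, at least \<open>m div 2\<close> vertices
        lie off the path.\<close>
      then have "card (V - set xs) \<ge> (j + 1) div 2"
        using V xs(1) Suc.prems by (simp add: card_Diff_subset)
      then show False using complementary_path[OF T xs(1,2), of "V - set xs"] * V Suc.hyps by auto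
    qed
    from xs(3) show ?case
    proof
      assume "gpath S xs"
      then show ?thesis using step[OF sym] by blast
    next
      assume "gpath (\<lambda>x y. \<not> S x y) xs"
      moreover have "symp (\<lambda>x y. \<not> S x y)" using sym by (auto simp: symp_def)
      ultimately show ?thesis using step by fastforce
    qed
  qed
  then show ?thesis using m by simp
qed

text \<open>The ends of a longest path have at least \<open>d\<close> neighbours each, all on the path, which has at most
  \<open>2 * d - 1\<close> vertices; as in Dirac's theorem, the path closes to a cycle, and no edge leaves a longest
  path that closes to a cycle.\<close>

lemma closed_set_of_min_degree:
  assumes sym: "symp S" and V: "finite V" "V \<noteq> {}"
    and deg: "\<And>x. x \<in> V \<Longrightarrow> card {y \<in> V. y \<noteq> x \<and> S x y} \<ge> d"
    and nop: "\<not> (\<exists>xs. gpath S xs \<and> set xs \<subseteq> V \<and> length xs = m)"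
    and m: "m \<le> 2 * d" "m \<ge> 1"
  shows "\<exists>C \<subseteq> V. d < card C \<and> card C < m \<and> (\<forall>x\<in>C. \<forall>y\<in>V - C. \<not> S x y)"
proof -
  note symD = sympD[OF sym]
  let ?P = "\<lambda>xs. gpath S xs \<and> set xs \<subseteq> V \<and> xs \<noteq> []"
  have short: "length xs < m" if "?P xs" for xs
  proof (rule ccontr)
    assume "\<not> length xs < m"
    then have "length (take m xs) = m" by simp
    moreover have "gpath S (take m xs)"
      using that by (metis append_take_drop_id gpath_append)
    moreover have "set (take m xs) \<subseteq> V" using that by (meson set_take_subset subset_trans)
    ultimately show False using nop by blast
  qed
  obtain x where "x \<in> V" using V by blast
  then have "?P [x]" by (auto simp: gpath_Cons gpath_Nil)
  then obtain xs where xs: "?P xs" and max: "\<And>ys. ?P ys \<Longrightarrow> length ys \<le> length xs"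
    using short ex_has_greatest_nat[of ?P "[x]" length m] by (metis less_imp_le)
  define k where "k = length xs"
  have k: "1 \<le> k" "k < m" using xs short by (auto simp: k_def Suc_le_eq)
  have dist: "distinct xs" using xs by (simp add: gpath_def)
  have hdx: "hd xs = xs ! 0" using xs by (simp add: hd_conv_nth)
  have lastx: "last xs = xs ! (k-1)" using xs by (simp add: last_conv_nth k_def)
  have first: "v \<in> set xs" if "v \<in> V" "S (hd xs) v" for v
    using max[of "v # xs"] xs that symD by (auto simp: gpath_Cons)
  have final: "v \<in> set xs" if "v \<in> V" "S (last xs) v" for v
    using max[of "xs @ [v]"] xs that by (auto simp: gpath_Cons gpath_append gpath_Nil)
  \<comment> \<open>Dirac's argument: an index in both sets gives edges from the two ends that cross
    over the same edge of the path.\<close>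
  define I where "I = {i. i < k - 1 \<and> S (hd xs) (xs ! Suc i)}"
  define J where "J = {i. i < k - 1 \<and> S (last xs) (xs ! i)}"
  have hV: "hd xs \<in> V" "last xs \<in> V" using xs hd_in_set last_in_set by blast+
  have "{y \<in> V. y \<noteq> hd xs \<and> S (hd xs) y} \<subseteq> (\<lambda>i. xs ! Suc i) ` I"
  proof
    fix y assume "y \<in> {y \<in> V. y \<noteq> hd xs \<and> S (hd xs) y}"
    then have y: "y \<noteq> hd xs" "S (hd xs) y" "y \<in> set xs" using first by auto
    then obtain j where j: "j < k" "y = xs ! j" by (auto simp: in_set_conv_nth k_def)
    with y hdx obtain i where "j = Suc i" by (cases j) auto
    then show "y \<in> (\<lambda>i. xs ! Suc i) ` I" using j y by (auto simp: I_def)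
  qed
  then have "card {y \<in> V. y \<noteq> hd xs \<and> S (hd xs) y} \<le> card I"
    by (rule surj_card_le[rotated]) (simp add: I_def)
  with deg[OF hV(1)] have I: "d \<le> card I" by linarith
  have "{y \<in> V. y \<noteq> last xs \<and> S (last xs) y} \<subseteq> (\<lambda>i. xs ! i) ` J"
  proof
    fix y assume "y \<in> {y \<in> V. y \<noteq> last xs \<and> S (last xs) y}"
    then have y: "y \<noteq> last xs" "S (last xs) y" "y \<in> set xs" using final by auto
    then obtain j where j: "j < k" "y = xs ! j" by (auto simp: in_set_conv_nth k_def)
    with y lastx have "j \<noteq> k - 1" by auto
    then show "y \<in> (\<lambda>i. xs ! i) ` J" using j y by (auto simp: J_def)
  qed
  then have "card {y \<in> V. y \<noteq> last xs \<and> S (last xs) y} \<le> card J"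
    by (rule surj_card_le[rotated]) (simp add: J_def)
  with deg[OF hV(2)] have J: "d \<le> card J" by linarith
  \<comment> \<open>Both sets lie below \<open>k - 1\<close>, while their sizes add up to at least
    \<open>2 * d \<ge> m > k\<close>, so they meet.\<close>
  have "card (I \<union> J) \<le> card {..<k-1}"
    by (rule card_mono) (auto simp: I_def J_def)
  then have "card (I \<union> J) < card I + card J" using I J k m by simp
  then have "I \<inter> J \<noteq> {}"
    using card_Un_disjoint[of I J] by (fastforce simp: I_def J_def)
  then obtain i where i: "i < k - 1" "S (hd xs) (xs ! Suc i)" "S (last xs) (xs ! i)"
    by (auto simp: I_def J_def)
  \<comment> \<open>Reversing the tail makes \<open>xs ! Suc i\<close> the last vertex, which is
    joined to the first.\<close>
  define ys where "ys = take (Suc i) xs @ rev (drop (Suc i) xs)"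
  have set_ys: "set ys = set xs"
    unfolding ys_def by (metis append_take_drop_id set_append set_rev)
  have len_ys: "length ys = k" using i by (simp add: ys_def k_def)
  have ne: "take (Suc i) xs \<noteq> []" "drop (Suc i) xs \<noteq> []" using xs i by (auto simp: k_def)
  have cut: "gpath S (take (Suc i) xs @ drop (Suc i) xs)" using xs by simp
  have "last (take (Suc i) xs) = xs ! i"
    using i by (subst last_conv_nth) (auto simp: k_def)
  moreover have "hd (rev (drop (Suc i) xs)) = last xs"
    using i by (simp add: hd_rev k_def)
  ultimately have ys: "gpath S ys"
    using cut[unfolded gpath_append] i symD unfolding ys_def
    by (auto simp: gpath_append gpath_rev[OF sym])
  have "last ys = xs ! Suc i"
    using ne i by (simp add: ys_def last_rev hd_drop_conv_nth k_def)
  moreover have "hd ys = hd xs" using xs by (simp add: ys_def)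
  ultimately have cyc: "S (last ys) (hd ys)" using i symD by simp
  have closed: "\<not> S x y" if x: "x \<in> set xs" and y: "y \<in> V - set xs" for x y
  proof
    assume "S x y"
    \<comment> \<open>An edge leaving the cycle opens it at \<open>x\<close> into a path longer than
      \<open>xs\<close>.\<close>
    obtain as bs where ab: "ys = as @ x # bs"
      using x set_ys by (metis split_list)
    have "gpath S (y # x # bs @ as)"
      using ys cyc y \<open>S x y\<close> symD set_ys unfolding ab
      by (auto simp: gpath_append gpath_Cons split: if_splits)
    moreover have "set (y # x # bs @ as) \<subseteq> V" using y set_ys xs unfolding ab by auto
    ultimately have "length (y # x # bs @ as) \<le> k" using max unfolding k_def by blast
    then show False using len_ys unfolding ab by simp
  qed
  have "card (set xs) = k" using dist by (simp add: distinct_card k_def)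
  moreover have "d \<le> k - 1"
  proof -
    have "card I \<le> card {..<k-1}" by (rule card_mono) (auto simp: I_def)
    then show ?thesis using I by simp
  qed
  ultimately show ?thesis using xs k closed by (intro exI[of _ "set xs"]) auto
qed

text \<open>Meant for the neighbourhood of a vertex in colour \<open>S\<close>: a path of that
  colour would give a kipas with that vertex as hub, and otherwise a kipas of the other colour lies
  inside the neighbourhood.\<close>

lemma path_kipas_ramsey:
  assumes sym: "symp S" and V: "finite V" "card V \<ge> 2 * m - 1" and m: "m \<ge> 2"
    and nop: "\<not> (\<exists>xs. gpath S xs \<and> set xs \<subseteq> V \<and> length xs = m)"
  shows "\<exists>v\<in>V. \<exists>xs. gpath (\<lambda>x y. \<not> S x y) xs \<and> set xs \<subseteq> V \<and> length xs = m
           \<and> v \<notin> set xs \<and> (\<forall>x\<in>set xs. \<not> S v x)"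
proof -
  note symD = sympD[OF sym]
  define d where "d = (m + 1) div 2"
  have Vne: "V \<noteq> {}" using V m by auto
  show ?thesis
  proof (cases "\<exists>v\<in>V. card {y \<in> V. y \<noteq> v \<and> S v y} < d")
    case True
    then obtain v where v: "v \<in> V" "card {y \<in> V. y \<noteq> v \<and> S v y} < d" by blast
    define U where "U = {y \<in> V. y \<noteq> v \<and> \<not> S v y}"
    have "V = insert v ({y \<in> V. y \<noteq> v \<and> S v y} \<union> U)" using v by (auto simp: U_def)
    then have "card V = card (insert v ({y \<in> V. y \<noteq> v \<and> S v y} \<union> U))" by (rule arg_cong)
    also have "\<dots> \<le> Suc (card ({y \<in> V. y \<noteq> v \<and> S v y} \<union> U))"
      using V(1) by (simp add: card_insert_if U_def)
    also have "\<dots> \<le> Suc (card {y \<in> V. y \<noteq> v \<and> S v y} + card U)"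
      using card_Un_le by simp
    \<comment> \<open>Removing \<open>v\<close> and at most \<open>d - 1\<close> neighbours from
      \<open>2 * m - 1\<close> vertices leaves exactly the size that \<open>path_path_ramsey\<close>
      asks for.\<close>
    finally have "card U \<ge> m + m div 2 - 1" using v V m unfolding d_def by linarith
    moreover have "finite U" using V by (simp add: U_def)
    ultimately obtain xs where xs: "set xs \<subseteq> U" "length xs = m"
      "gpath S xs \<or> gpath (\<lambda>x y. \<not> S x y) xs"
      using path_path_ramsey[OF sym _ _ m] by blast
    then show ?thesis using nop v(1) unfolding U_def by blast
  next
    case False
    then have deg: "card {y \<in> V. y \<noteq> v \<and> S v y} \<ge> d" if "v \<in> V" for v
      using that by force
    have md: "m \<le> 2 * d" and m1: "m \<ge> 1" using m by (simp_all add: d_def)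
    obtain C where C: "C \<subseteq> V" "d < card C" "card C < m" "\<forall>x\<in>C. \<forall>y\<in>V - C. \<not> S x y"
      using closed_set_of_min_degree[OF sym V(1) Vne deg nop md m1] by blast
    define D where "D = V - C"
    \<comment> \<open>\<open>C\<close> has at most \<open>m - 1\<close> of the at least
      \<open>2 * m - 1\<close> vertices. Hence \<open>D\<close> is not exhausted by a second such
      set, and a vertex remains outside both.\<close>
    have "card D \<ge> m" using V C by (simp add: D_def card_Diff_subset finite_subset)
    have "finite D" using V by (simp add: D_def)
    moreover have "D \<noteq> {}" using \<open>card D \<ge> m\<close> m1 by auto
    ultimately have fD: "finite D" "D \<noteq> {}" .
    \<comment> \<open>No edge leaves \<open>C\<close>, so degrees within \<open>D\<close> are those
      within \<open>V\<close>.\<close>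
    have degD: "card {y \<in> D. y \<noteq> v \<and> S v y} \<ge> d" if "v \<in> D" for v
    proof -
      have "{y \<in> D. y \<noteq> v \<and> S v y} = {y \<in> V. y \<noteq> v \<and> S v y}"
        using that C(4) symD by (auto simp: D_def)
      then show ?thesis using deg that by (simp add: D_def)
    qed
    have nopD: "\<not> (\<exists>xs. gpath S xs \<and> set xs \<subseteq> D \<and> length xs = m)"
      using nop by (auto simp: D_def)
    obtain C' where C': "C' \<subseteq> D" "d < card C'" "card C' < m" "\<forall>x\<in>C'. \<forall>y\<in>D - C'. \<not> S x y"
      using closed_set_of_min_degree[OF sym fD degD nopD md m1] by blast
    obtain v where v: "v \<in> D" "v \<notin> C'"
      using C'(1,3) \<open>card D \<ge> m\<close> by (metis leD subsetI subset_antisym)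
    have sizes: "m div 2 \<le> card C" "(m + 1) div 2 \<le> card C'"
      using C(2) C'(2) by (auto simp: d_def)
    obtain A where A: "A \<subseteq> C" "card A = m div 2" "finite A"
      using obtain_subset_with_card_n[OF sizes(1)] by blast
    obtain B where B: "B \<subseteq> C'" "card B = (m + 1) div 2" "finite B"
      using obtain_subset_with_card_n[OF sizes(2)] by blast
    have disj: "A \<inter> B = {}" using A B C'(1) by (auto simp: D_def)
    have edge: "\<not> S a b \<and> \<not> S b a" if "a \<in> A" "b \<in> B" for a b
    proof -
      have "a \<in> C" "b \<in> V - C" using that A(1) B(1) C'(1) by (auto simp: D_def)
      then show ?thesis using C(4) symD by blast
    qed
    obtain xs where xs: "gpath (\<lambda>x y. \<not> S x y) xs" "length xs = m" "set xs \<subseteq> A \<union> B"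
      using gpath_bipartite[OF A(3) B(3) disj A(2) B(2), of "\<lambda>x y. \<not> S x y"] edge by blast
    have "\<not> S v x" if "x \<in> set xs" for x
    proof -
      have "x \<in> C \<and> v \<in> V - C \<or> x \<in> C' \<and> v \<in> D - C'"
        using that xs(3) A(1) B(1) v by (auto simp: D_def)
      then show ?thesis using C(4) C'(4) symD by blast
    qed
    moreover have "v \<notin> set xs" "set xs \<subseteq> V" "v \<in> V"
      using xs(3) A(1) B(1) v C(1) C'(1) unfolding D_def by blast+
    ultimately show ?thesis using xs by blast
  qed
qed

section \<open>Monochromatic kipases\<close>

text \<open>A copy of the kipas unfolded: \<open>v\<close> is the hub, the image of
  \<open>None\<close>, and \<open>p i\<close> is the image of \<open>Some i\<close>.\<close>

definition mono_kipas :: "nat \<Rightarrow> (nat set \<Rightarrow> color) \<Rightarrow> color \<Rightarrow> nat \<Rightarrow> bool" where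
  "mono_kipas N c k n \<longleftrightarrow> (\<exists>v p. inj_on p {..<n-1} \<and> p ` {..<n-1} \<subseteq> {..<N} \<and> v < N \<and> v \<notin> p ` {..<n-1}
     \<and> (\<forall>i<n-1. c {v, p i} = k) \<and> (\<forall>i. Suc i < n-1 \<longrightarrow> c {p i, p (Suc i)} = k))"

lemma contains_copy_kipas_iff:
  "contains_copy (color_subgraph (complete_graph N) c k) (kipas n) \<longleftrightarrow> mono_kipas N c k n"
proof
  assume "contains_copy (color_subgraph (complete_graph N) c k) (kipas n)"
  then obtain f where f: "inj_on f (verts (kipas n))" "f ` verts (kipas n) \<subseteq> {..<N}"
    "\<And>e. e \<in> edges (kipas n) \<Longrightarrow> c (f ` e) = k"
    by (auto simp: contains_copy_def color_subgraph_def complete_graph_def)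
  define p where "p = f \<circ> Some"
  have "inj_on p {..<n-1}"
    using f(1) by (auto simp: p_def kipas_def K1_join_def path_graph_def inj_on_def)
  moreover have "p ` {..<n-1} \<subseteq> {..<N}" "f None < N"
    using f(2) by (auto simp: p_def kipas_def K1_join_def path_graph_def)
  moreover have "f None \<notin> p ` {..<n-1}"
    using f(1) by (auto simp: p_def kipas_def K1_join_def path_graph_def inj_on_def)
  moreover have "c {f None, p i} = k" if "i < n-1" for i
    using f(3)[of "{None, Some i}"] that
    by (auto simp: p_def kipas_def K1_join_def path_graph_def)
  moreover have "c {p i, p (Suc i)} = k" if "Suc i < n-1" for i
  proof -
    have "{i, Suc i} \<in> edges (path_graph (n-1))"
      using that by (auto simp: path_graph_def)
    then have "Some ` {i, Suc i} \<in> edges (kipas n)"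
      unfolding kipas_def K1_join_def ugraph.simps by (intro UnI1 imageI)
    from f(3)[OF this] show ?thesis by (simp add: p_def)
  qed
  ultimately show "mono_kipas N c k n"
    unfolding mono_kipas_def by (intro exI[of _ "f None"] exI[of _ p]) blast
next
  assume "mono_kipas N c k n"
  then obtain v p where p: "inj_on p {..<n-1}" "p ` {..<n-1} \<subseteq> {..<N}" "v < N" "v \<notin> p ` {..<n-1}"
    "\<And>i. i<n-1 \<Longrightarrow> c {v, p i} = k" "\<And>i. Suc i < n-1 \<Longrightarrow> c {p i, p (Suc i)} = k"
    unfolding mono_kipas_def by blast
  define f where "f = case_option v p"
  have "inj_on f (verts (kipas n))"
    using p(1,4) by (auto simp: f_def kipas_def K1_join_def path_graph_def inj_on_def)
  moreover have "f ` verts (kipas n) \<subseteq> {..<N}"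
    using p(2,3) by (auto simp: f_def kipas_def K1_join_def path_graph_def)
  moreover have "f ` e \<in> nsets {..<N} 2 \<and> c (f ` e) = k" if e: "e \<in> edges (kipas n)" for e
  proof -
    from e consider (a) i where "Suc i < n-1" "e = {Some i, Some (Suc i)}"
      | (b) i where "i < n-1" "e = {None, Some i}"
      by (auto simp: kipas_def K1_join_def path_graph_def)
    then show ?thesis
    proof cases
      case a
      have "p i \<noteq> p (Suc i)" using inj_onD[OF p(1), of i "Suc i"] a by auto
      moreover have "p i < N" "p (Suc i) < N" using p(2) a by (auto simp: image_subset_iff)
      ultimately show ?thesis using a p(6) by (auto simp: f_def nsets_def)
    next
      case b
      have "v \<noteq> p i" using p(4) b by auto
      then show ?thesis using b p(2,3,5) by (auto simp: f_def nsets_def)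
    qed
  qed
  ultimately show "contains_copy (color_subgraph (complete_graph N) c k) (kipas n)"
    unfolding contains_copy_def
    by (intro exI[of _ f]) (auto simp: color_subgraph_def complete_graph_def)
qed

lemma mono_kipasI:
  assumes "gpath S xs" "length xs = n - 1" "set xs \<subseteq> {..<N}" "v < N" "v \<notin> set xs"
    and "\<And>x. x \<in> set xs \<Longrightarrow> c {v, x} = k" "\<And>x y. S x y \<Longrightarrow> x \<noteq> y \<Longrightarrow> c {x, y} = k"
  shows "mono_kipas N c k n"
proof -
  have d: "distinct xs" "successively S xs" using assms(1) by (auto simp: gpath_def)
  have "inj_on ((!) xs) {..<n-1}" using d assms(2) by (intro inj_on_nth) auto
  moreover have img: "(!) xs ` {..<n-1} = set xs"
    using assms(2) by (auto simp: in_set_conv_nth image_iff)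
  moreover have "c {xs ! i, xs ! Suc i} = k" if "Suc i < n-1" for i
  proof (rule assms(7))
    show "S (xs ! i) (xs ! Suc i)" using d(2) that assms(2) by (simp add: successively_conv_nth)
    show "xs ! i \<noteq> xs ! Suc i" using d(1) that assms(2) by (simp add: nth_eq_iff_index_eq)
  qed
  ultimately show ?thesis using assms unfolding mono_kipas_def
    by (intro exI[of _ v] exI[of _ "(!) xs"]) auto
qed

lemma ramsey_kipas_def:
  "ramsey_number (kipas n) (kipas n)
     = (LEAST N. N > 0 \<and> (\<forall>c. mono_kipas N c Red n \<or> mono_kipas N c Blue n))"
  by (simp add: ramsey_number_def contains_copy_kipas_iff)

lemma mono_kipas_mono:
  assumes "mono_kipas M c k n" "M \<le> N"
  shows "mono_kipas N c k n"
proof -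
  have "{..<M} \<subseteq> {..<N}" using assms(2) by simp
  then show ?thesis
    using assms unfolding mono_kipas_def by (meson order_less_le_trans subset_trans)
qed

section \<open>The upper bound\<close>

text \<open>One colour class at vertex 0 is large. A path of its colour in that class has 0 as hub;
  otherwise \<open>path_kipas_ramsey\<close> finds a kipas of the other colour there.\<close>

lemma mono_kipas_upper:
  assumes n: "n \<ge> 3" and N: "N = 4 * n - 6"
  shows "mono_kipas N c Red n \<or> mono_kipas N c Blue n"
proof -
  define U where "U k = {x. 0 < x \<and> x < N \<and> c {0, x} = k}" for k
  have fin: "finite (U k)" for k by (simp add: U_def)
  have "{1..<N} = U Red \<union> U Blue"
  proof (intro set_eqI)
    show "x \<in> {1..<N} \<longleftrightarrow> x \<in> U Red \<union> U Blue" for x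
      by (cases "c {0, x}") (auto simp: U_def)
  qed
  then have "N - 1 \<le> card (U Red) + card (U Blue)"
    by (metis card_Un_le card_atLeastLessThan)
  \<comment> \<open>Two classes of size at most \<open>2 * (n-1) - 2\<close> would not fill the
    \<open>N - 1 = 4 * (n-1) - 3\<close> vertices.\<close>
  then have "card (U Red) \<ge> 2 * (n-1) - 1 \<or> card (U Blue) \<ge> 2 * (n-1) - 1"
    using N n by linarith
  then obtain k where k: "card (U k) \<ge> 2 * (n-1) - 1" by blast
  obtain k' where k': "k' \<noteq> k" using that[of Red] that[of Blue] by (cases k) auto
  have flip: "c e \<noteq> k \<longleftrightarrow> c e = k'" for e using k' by (cases "c e"; cases k; cases k') auto
  let ?S = "\<lambda>x y. c {x, y} = k"
  have sym: "symp ?S" by (simp add: symp_def insert_commute)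
  have "mono_kipas N c k n \<or> mono_kipas N c k' n"
  proof (cases "\<exists>xs. gpath ?S xs \<and> set xs \<subseteq> U k \<and> length xs = n - 1")
    case True
    then obtain xs where xs: "gpath ?S xs" "set xs \<subseteq> U k" "length xs = n - 1" by blast
    then have "mono_kipas N c k n"
      using N n by (intro mono_kipasI[of ?S xs _ _ 0]) (auto simp: U_def)
    then show ?thesis ..
  next
    case False
    have "n - 1 \<ge> 2" using n by simp
    from path_kipas_ramsey[OF sym fin k this False] obtain v xs
      where "v \<in> U k" "gpath (\<lambda>x y. c {x, y} \<noteq> k) xs" "set xs \<subseteq> U k" "length xs = n - 1"
        "v \<notin> set xs" "\<forall>x\<in>set xs. c {v, x} \<noteq> k" by blast
    then have "mono_kipas N c k' n" unfolding flip
      by (intro mono_kipasI[of "\<lambda>x y. c {x, y} = k'" xs _ _ v]) (auto simp: U_def)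
    then show ?thesis ..
  qed
  then show ?thesis using k' by (cases k; cases k') auto
qed

lemma ramsey_kipas_le:
  assumes "n \<ge> 3"
  shows "ramsey_number (kipas n) (kipas n) \<le> 4 * n - 6"
  unfolding ramsey_kipas_def using mono_kipas_upper[OF assms refl] assms
  by (intro Least_le) auto

text \<open>The upper bound provides an admissible order, so the \<open>LEAST\<close> is itself
  admissible; \<open>mono_kipas_mono\<close> then excludes every order up to that of a bad
  colouring.\<close>

lemma ramsey_kipas_greater:
  assumes n: "n \<ge> 3" and c: "\<not> mono_kipas N c Red n" "\<not> mono_kipas N c Blue n"
  shows "N < ramsey_number (kipas n) (kipas n)"
proof -
  let ?P = "\<lambda>N. N > 0 \<and> (\<forall>c. mono_kipas N c Red n \<or> mono_kipas N c Blue n)"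
  have "?P (4 * n - 6)" using mono_kipas_upper[OF n refl] n by auto
  then have "?P (ramsey_number (kipas n) (kipas n))" unfolding ramsey_kipas_def by (rule LeastI)
  then show ?thesis using c mono_kipas_mono by (meson not_le)
qed

section \<open>The lower bound\<close>

text \<open>Within a set \<open>A\<close> of \<open>q * c\<close> vertices, blue is the disjoint union of \<open>q\<close> circulant graphs on \<open>c\<close>
  vertices with connection set \<open>D\<close>; the remaining \<open>n - 1\<close> vertices form a red clique, and are joined
  to \<open>A\<close> in blue. All red degrees are at most \<open>n - 2\<close>. A blue path in the neighbourhood of a vertex
  of the clique stays in a single circulant graph, and one in the neighbourhood of a vertex of \<open>A\<close>
  never visits two vertices of the clique in succession.\<close>

lemma ramsey_kipas_circulant:
  assumes n: "n \<ge> 3" and D: "D \<subseteq> {1..<c}" "\<And>s. s \<in> D \<Longrightarrow> c - s \<in> D"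
    and c: "0 < c" "c \<le> n - 2" and d: "2 * card D + 1 \<le> n - 2" and q: "q * c \<le> n - 1 + card D"
  shows "q * c + (n - 1) < ramsey_number (kipas n) (kipas n)"
proof -
  define a where "a = q * c"
  define M where "M = a + (n - 1)"
  \<comment> \<open>A vertex \<open>x < a\<close> sits in block \<open>x div c\<close> at position
    \<open>x mod c\<close>; \<open>S\<close> shifts the position by an element of
    \<open>D\<close>.\<close>
  define S where "S x y \<longleftrightarrow> x div c = y div c \<and> (\<exists>s\<in>D. y mod c = (x mod c + s) mod c)" for x y
  define nb where "nb x = {y. y < a \<and> S x y}" for x
  \<comment> \<open>A colouring acts on sets, so both orders of a pair are tried; the symmetry of
    \<open>S\<close> then yields \<open>blue\<close>.\<close>
  define col where "col e = (if \<exists>x y. e = {x, y} \<and> x < a \<and> (a \<le> y \<or> S x y) then Blue else Red)"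
    for e :: "nat set"
  have Dbd: "0 < s" "s < c" if "s \<in> D" for s using D(1) that by auto
  have shift: "(u + s) mod c = (if u + s < c then u + s else u + s - c)" if "u < c" "s < c" for u s
    using that by (auto simp: mod_if)
  have S_sym: "S y x" if xy: "S x y" for x y
  proof -
    obtain s where s: "s \<in> D" "y mod c = (x mod c + s) mod c" "x div c = y div c"
      using xy unfolding S_def by blast
    \<comment> \<open>Shifting back by \<open>s\<close> is shifting by \<open>c - s\<close>, again
      an element of \<open>D\<close>.\<close>
    have "(y mod c + (c - s)) mod c = (x mod c + s + (c - s)) mod c"
      unfolding s(2) by (rule mod_add_left_eq)
    also have "x mod c + s + (c - s) = x mod c + c" using Dbd[OF s(1)] by simp
    finally have "x mod c = (y mod c + (c - s)) mod c" by simp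
    then show ?thesis using s D(2) unfolding S_def by metis
  qed
  have S_irrefl: "\<not> S x x" for x
  proof
    assume "S x x"
    then obtain s where s: "s \<in> D" "x mod c = (x mod c + s) mod c"
      unfolding S_def by blast
    have "x mod c < c" using c by simp
    then show False using s Dbd[OF s(1)] shift[of "x mod c" s] by (auto split: if_splits)
  qed
  have blue: "col {x, y} = Blue \<longleftrightarrow> x < a \<and> a \<le> y \<or> y < a \<and> a \<le> x \<or> x < a \<and> y < a \<and> S x y" for x y
    unfolding col_def using S_sym by (auto simp: doubleton_eq_iff)
  have red: "col e = Red \<longleftrightarrow> col e \<noteq> Blue" for e by (simp add: col_def)
  have nb_card: "card (nb x) = card D" if x: "x < a" for x
  proof -
    \<comment> \<open>\<open>g\<close> lists the neighbours of \<open>x\<close> inside its block,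
      one for each shift.\<close>
    define g where "g s = (x div c) * c + (x mod c + s) mod c" for s
    have u: "x mod c < c" using c by simp
    have "x div c < q" using x c by (simp add: a_def less_mult_imp_div_less)
    then have "Suc (x div c) * c \<le> q * c" by (intro mult_le_mono) auto
    then have "g s < a" for s
      using mod_less_divisor[OF c(1), of "x mod c + s"] by (simp add: g_def a_def)
    moreover have "g s div c = x div c" "g s mod c = (x mod c + s) mod c" for s
      using c(1) by (simp_all add: g_def)
    moreover have "y = g s" if "x div c = y div c" "y mod c = (x mod c + s) mod c" for y s
      using div_mult_mod_eq[of y c] that by (simp add: g_def)
    ultimately have "y \<in> nb x \<longleftrightarrow> y \<in> g ` D" for y
      unfolding nb_def S_def image_iff mem_Collect_eq by metis
    then have "nb x = g ` D" by blast
    moreover have "inj_on g D"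
    proof (rule inj_onI)
      fix s t assume st: "s \<in> D" "t \<in> D" "g s = g t"
      then have "(x mod c + s) mod c = (x mod c + t) mod c" by (simp add: g_def)
      then show "s = t"
        using shift[OF u Dbd(2)[OF st(1)]] shift[OF u Dbd(2)[OF st(2)]] Dbd[OF st(1)] Dbd[OF st(2)]
        by (auto split: if_splits)
    qed
    ultimately show ?thesis by (simp add: card_image)
  qed
  \<comment> \<open>This rules out a red hub, which needs red degree \<open>n - 1\<close>. For
    \<open>v < a\<close> the bound on \<open>q * c\<close> enters here.\<close>
  have red_deg: "card {y. y < M \<and> y \<noteq> v \<and> col {v, y} = Red} \<le> n - 2" if v: "v < M" for v
  proof (cases "v < a")
    case True
    have "{y. y < M \<and> y \<noteq> v \<and> col {v, y} = Red} \<subseteq> {..<a} - insert v (nb v)"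
      using True by (auto simp: red blue nb_def)
    then have "card {y. y < M \<and> y \<noteq> v \<and> col {v, y} = Red} \<le> card ({..<a} - insert v (nb v))"
      by (intro card_mono) auto
    also have "\<dots> = a - card (insert v (nb v))"
      using True by (subst card_Diff_subset) (auto simp: nb_def)
    also have "card (insert v (nb v)) = Suc (card D)"
      using S_irrefl nb_card[OF True] by (subst card_insert_disjoint) (auto simp: nb_def)
    finally show ?thesis using q n by (simp add: a_def)
  next
    case False
    have "{y. y < M \<and> y \<noteq> v \<and> col {v, y} = Red} \<subseteq> {a..<M} - {v}"
      using False by (auto simp: red blue)
    then have "card {y. y < M \<and> y \<noteq> v \<and> col {v, y} = Red} \<le> card ({a..<M} - {v})"
      by (intro card_mono) auto
    also have "\<dots> = n - 2" using False v by (simp add: M_def)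
    finally show ?thesis .
  qed
  have "\<not> mono_kipas M col Red n"
  proof
    assume "mono_kipas M col Red n"
    then obtain v p where p: "inj_on p {..<n-1}" "p ` {..<n-1} \<subseteq> {..<M}" "v < M" "v \<notin> p ` {..<n-1}"
      "\<And>i. i<n-1 \<Longrightarrow> col {v, p i} = Red"
      unfolding mono_kipas_def by blast
    have "p ` {..<n-1} \<subseteq> {y. y < M \<and> y \<noteq> v \<and> col {v, y} = Red}"
      using p(2,4,5) by auto
    then have "n - 1 \<le> card {y. y < M \<and> y \<noteq> v \<and> col {v, y} = Red}"
      using card_inj_on_le[OF p(1)] by simp
    then show False using red_deg[OF p(3)] n by simp
  qed
  moreover have "\<not> mono_kipas M col Blue n"
  proof
    assume "mono_kipas M col Blue n"
    then obtain v p where p: "inj_on p {..<n-1}" "v < M" "\<And>i. i < n-1 \<Longrightarrow> col {v, p i} = Blue"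
      "\<And>i. Suc i < n-1 \<Longrightarrow> col {p i, p (Suc i)} = Blue"
      unfolding mono_kipas_def by blast
    show False
    proof (cases "v < a")
      case True
      define I where "I = {i. i < n - 1 \<and> a \<le> p i}"
      define J where "J = {i. i < n - 1 \<and> p i < a}"
      have fin: "finite I" "finite J" by (auto simp: I_def J_def)
      have "p i \<in> nb v" if "i \<in> J" for i
        using p(3)[of i] that True by (auto simp: J_def blue nb_def)
      then have "p ` J \<subseteq> nb v" by blast
      moreover have "inj_on p J" using p(1) by (rule inj_on_subset) (auto simp: J_def)
      ultimately have J: "card J \<le> card D"
        using card_inj_on_le[of p J "nb v"] nb_card[OF True] by (auto simp: nb_def)
      \<comment> \<open>A clique vertex on the path comes first or right after a vertex below
        \<open>a\<close>; hence \<open>n - 1 \<le> 2 * card D + 1\<close>.\<close>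
      have "I \<subseteq> insert 0 (Suc ` J)"
      proof
        fix i assume i: "i \<in> I"
        show "i \<in> insert 0 (Suc ` J)"
        proof (cases i)
          case (Suc j)
          then show ?thesis using p(4)[of j] i by (auto simp: I_def J_def blue)
        qed simp
      qed
      then have "card I \<le> card (insert 0 (Suc ` J))"
        using fin by (intro card_mono) auto
      then have "card I \<le> Suc (card J)"
        using fin by (simp add: card_image)
      moreover have "{..<n-1} = I \<union> J" by (auto simp: I_def J_def)
      then have "n - 1 \<le> card I + card J" by (metis card_Un_le card_lessThan)
      ultimately show False using J d by linarith
    next
      case False
      have low: "p i < a" if "i < n - 1" for i
        using p(3)[OF that] False by (auto simp: blue)
      have "p i div c = p 0 div c" if "i < n - 1" for i
        using that
      proof (induction i)
        case (Suc i)
        then have "S (p i) (p (Suc i))"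
          using p(4)[of i] low[of i] low[of "Suc i"] by (auto simp: blue)
        then show ?case using Suc by (simp add: S_def)
      qed simp
      then have "p ` {..<n-1} \<subseteq> (\<lambda>r. p 0 div c * c + r) ` {..<c}"
        using div_mult_mod_eq[of _ c] c(1)
        by (metis (no_types, lifting) image_eqI image_subsetI lessThan_iff mod_less_divisor)
      then have "n - 1 \<le> c"
        using card_inj_on_le[OF p(1)] card_image_le[of "{..<c}" "\<lambda>r. p 0 div c * c + r"]
        by (metis card_lessThan finite_imageI finite_lessThan le_trans)
      then show False using c n by linarith
    qed
  qed
  ultimately have "M < ramsey_number (kipas n) (kipas n)" by (rule ramsey_kipas_greater[OF n])
  then show ?thesis by (simp add: M_def a_def)
qed

theorem theorem5:
  fixes n :: nat
  assumes "n \<ge> 5"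
  shows "(5 * real n - 6 + sgn' n) / 2 \<le> real (ramsey_number (kipas n) (kipas n))
       \<and> real (ramsey_number (kipas n) (kipas n)) \<le> 4 * real n - 6"
proof
  have "even n \<or> n mod 4 = 1 \<or> n mod 4 = 3" by presburger
  then consider (even) "even n" | (one) "n mod 4 = 1" | (three) "n mod 4 = 3" by blast
  then show "(5 * real n - 6 + sgn' n) / 2 \<le> real (ramsey_number (kipas n) (kipas n))"
  proof cases
    case even
    then obtain h where h: "n = 2 * h" by (elim evenE)
    \<comment> \<open>Three blocks, each a blue complete graph on \<open>h - 1\<close> vertices,
      since \<open>D\<close> holds all nonzero residues.\<close>
    have "3 * (h - 1) + (n - 1) < ramsey_number (kipas n) (kipas n)"
      using h assms by (intro ramsey_kipas_circulant[where D = "{1..<h-1}"]) auto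
    then have "5 * n \<le> 2 * ramsey_number (kipas n) (kipas n) + 6"
      using h assms by linarith
    from of_nat_mono[where 'a = real, OF this]
    have "5 * real n \<le> 2 * real (ramsey_number (kipas n) (kipas n)) + 6" by simp
    moreover have "sgn' n = 0" using even by (auto simp: sgn'_def) presburger
    ultimately show ?thesis by simp
  next
    case one
    define k where "k = n div 4"
    have k: "n = 4 * k + 1" "k \<ge> 1" using one assms by (auto simp: k_def) presburger
    \<comment> \<open>Here \<open>c = 3 * k - 1\<close>, and \<open>s \<mapsto> c - s\<close>
      exchanges the two intervals. Two blocks give the equality
      \<open>q * c = n - 1 + card D\<close>.\<close>
    define D where "D = {1..k-1} \<union> {2*k..3*k-2}"
    have "card D = 2 * k - 2"
      unfolding D_def using k by (subst card_Un_disjoint) auto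
    then have "2 * (3 * k - 1) + (n - 1) < ramsey_number (kipas n) (kipas n)"
      using k by (intro ramsey_kipas_circulant[where D = D]) (auto simp: D_def)
    then have "5 * n \<le> 2 * ramsey_number (kipas n) (kipas n) + 7"
      using k by linarith
    from of_nat_mono[where 'a = real, OF this]
    have "5 * real n \<le> 2 * real (ramsey_number (kipas n) (kipas n)) + 7" by simp
    moreover have "sgn' n = -1" using one by (auto simp: sgn'_def) presburger
    ultimately show ?thesis by simp
  next
    case three
    define k where "k = n div 4"
    have k: "n = 4 * k + 3" "k \<ge> 1" using three assms by (auto simp: k_def) presburger
    \<comment> \<open>Again two blocks, now with \<open>c = 3 * k + 1\<close>; both
      \<open>2 * card D + 1 = n - 2\<close> and \<open>q * c = n - 1 + card D\<close> hold.\<close>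
    define D where "D = {1..k} \<union> {2*k+1..3*k}"
    have "card D = 2 * k"
      unfolding D_def using k by (subst card_Un_disjoint) auto
    then have "2 * (3 * k + 1) + (n - 1) < ramsey_number (kipas n) (kipas n)"
      using k by (intro ramsey_kipas_circulant[where D = D]) (auto simp: D_def)
    then have "5 * n \<le> 2 * ramsey_number (kipas n) (kipas n) + 5"
      using k by simp
    from of_nat_mono[where 'a = real, OF this]
    have "5 * real n \<le> 2 * real (ramsey_number (kipas n) (kipas n)) + 5" by simp
    moreover have "sgn' n = 1" using three by (auto simp: sgn'_def)
    ultimately show ?thesis by simp
  qed
next
  have "ramsey_number (kipas n) (kipas n) \<le> 4 * n - 6"
    using assms by (intro ramsey_kipas_le) simp
  then show "real (ramsey_number (kipas n) (kipas n)) \<le> 4 * real n - 6"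
    using assms by linarith
qed

end
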